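(* Let $\Sigma$ be a finite alphabet and $\mathbb{D}$ a value domain. Every $\mathsf{LimInf}$-property $\varPhi : \Sigma^\omega \to \mathbb{D}$ is a countable supremum of $\mathsf{Inf}$-properties; that is, there is a sequence $(\varPhi_i)_{i \in \mathbb{N}}$ of $\mathsf{Inf}$-properties $\varPhi_i : \Sigma^\omega \to \mathbb{D}$ such that $\varPhi(w) = \sup_{i \in \mathbb{N}} \varPhi_i(w)$ for all $w \in \Sigma^\omega$.
   Context: $\Sigma^*$ and $\Sigma^\omega$ are the sets of finite and infinite words over the finite nonempty alphabet $\Sigma$; $u \prec w$ means that the finite word $u$ is a strict prefix of $w$ (the empty word is allowed). A value domain $\mathbb{D}$ is a complete lattice with $\bot \neq \top$. A property is a total function $\varPhi : \Sigma^\omega \to \mathbb{D}$. For a function $\pi : \Sigma^* \to \mathbb{D}$ (a finitary property) and $w \in \Sigma^\omega$, let $u_i$ be the prefix of $w$ of length $i$. $\varPhi$ is an $\mathsf{Inf}$-property when there is $\pi : \Sigma^* \to \mathbb{D}$ with $\varPhi(w) = \inf_{i \geq 0} \pi(u_i)$ for all $w$. $\varPhi$ is a $\mathsf{LimInf}$-property when there is $\pi : \Sigma^* \to \mathbb{D}$ with $\varPhi(w) = \sup_{n \geq 0} \inf_{i \geq n} \pi(u_i)$ for all $w$. *)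

theory Defs
  imports "HOL-Library.Stream"
begin

text \<open>
  A finite nonempty alphabet is a type of class \<^class>\<open>finite\<close>; finite words are lists and
  infinite words are streams, so that \<open>stake i w\<close> is the prefix of \<open>w\<close> of length \<open>i\<close>.
  A value domain is a type of class \<^class>\<open>complete_lattice\<close>; that class admits the one-element
  lattice, so \<open>bot \<noteq> top\<close> has to be assumed where it is used.
\<close>

type_synonym ('a, 'd) property = "'a stream \<Rightarrow> 'd"

type_synonym ('a, 'd) finitary_property = "'a list \<Rightarrow> 'd"

definition Inf_property :: "('a::finite, 'd::complete_lattice) property \<Rightarrow> bool" where
  "Inf_property \<Phi> \<longleftrightarrow>
     (\<exists>\<pi> :: ('a, 'd) finitary_property. \<forall>w. \<Phi> w = (INF i. \<pi> (stake i w)))"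

definition LimInf_property :: "('a::finite, 'd::complete_lattice) property \<Rightarrow> bool" where
  "LimInf_property \<Phi> \<longleftrightarrow>
     (\<exists>\<pi> :: ('a, 'd) finitary_property. \<forall>w. \<Phi> w = (SUP n. INF i\<in>{n..}. \<pi> (stake i w)))"

end

theory Submission
  imports Defs
begin

text \<open>The outer supremum in a limit inferior already ranges over the naturals, so it is enough
  that each tail infimum over \<open>{n..}\<close> is an Inf-property.
  \<open>Inf_property_INF_atLeast\<close> gives this: a finitary property can read off the length of
  its argument, hence can neutralise all prefixes shorter than \<open>n\<close>.\<close>

lemma Inf_property_INF_atLeast:
  fixes \<pi> :: "('a::finite, 'd::complete_lattice) finitary_property"
  shows "Inf_property (\<lambda>w. INF i\<in>{n..}. \<pi> (stake i w))"
proof -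
  \<comment> \<open>The value \<open>top\<close> is neutral for infima, so the indices below
    \<open>n\<close> drop out. The test is on \<open>length (stake i w)\<close>, which equals
    \<open>i\<close>, because the new finitary property sees only the prefix and not the
    index.\<close>
  have "(INF i\<in>{n..}. \<pi> (stake i w)) =
        (INF i. if length (stake i w) < n then top else \<pi> (stake i w))" for w
  proof (rule antisym)
    show "(INF i\<in>{n..}. \<pi> (stake i w)) \<le>
          (INF i. if length (stake i w) < n then top else \<pi> (stake i w))"
      by (rule INF_greatest) (auto intro: INF_lower)
    show "(INF i. if length (stake i w) < n then top else \<pi> (stake i w)) \<le>
          (INF i\<in>{n..}. \<pi> (stake i w))"
    proof (rule INF_greatest)
      fix i assume "i \<in> {n..}"
      then show "(INF i. if length (stake i w) < n then top else \<pi> (stake i w)) \<le> \<pi> (stake i w)"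
        by (intro INF_lower2[of i]) auto
    qed
  qed
  then show ?thesis
    unfolding Inf_property_def
    by (intro exI[of _ "\<lambda>u. if length u < n then top else \<pi> u"]) blast
qed

theorem theorem4p15:
  fixes \<Phi> :: "('a::finite, 'd::complete_lattice) property"
  assumes "(bot :: 'd) \<noteq> top"
    and "LimInf_property \<Phi>"
  shows "\<exists>\<Psi> :: nat \<Rightarrow> ('a, 'd) property.
           (\<forall>i. Inf_property (\<Psi> i)) \<and> (\<forall>w. \<Phi> w = (SUP i. \<Psi> i w))"
proof -
  obtain \<pi> :: "('a, 'd) finitary_property"
    where "\<forall>w. \<Phi> w = (SUP n. INF i\<in>{n..}. \<pi> (stake i w))"
    using assms(2) unfolding LimInf_property_def by blast
  then show ?thesis
    \<comment> \<open>With the tail infima as the sequence, the supremum equation is exactly the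
      choice of \<open>\<pi>\<close>.\<close>
    by (intro exI[of _ "\<lambda>n w. INF i\<in>{n..}. \<pi> (stake i w)"])
       (simp add: Inf_property_INF_atLeast)
qed

end
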